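(* Let $\beta\ge 0$ and, for $y\in\mathbb R$, let $\tilde\eta^*(y)=\min_{d\in\mathcal D}\{\beta\tilde\sigma^d(y)-\mu^d\}$. Then $\tilde\eta^*$ is continuous in $y$ and is piecewise quadratic with convex pieces: $\mathbb R$ is a union of finitely many closed intervals (possibly unbounded) on each of which $\tilde\eta^*$ coincides with a convex quadratic function of $y$ (a polynomial of degree at most $2$ with nonnegative leading coefficient). Moreover, its global minimum gives the optimal solution of the mean-variance optimization problem: $\min_{y\in\mathbb R}\tilde\eta^*(y)=\min_{d\in\mathcal D}\{\beta\sigma^d-\mu^d\}$, and if $y^*$ is a global minimizer of $\tilde\eta^*$ and $\tilde d^*\in\arg\min_{d\in\mathcal D}\{\beta\tilde\sigma^d(y^* )-\mu^d\}$, then $\tilde d^*\in\arg\min_{d\in\mathcal D}\{\beta\sigma^d-\mu^d\}$.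
   Context: MDP setting. $\mathcal S=\{1,\dots,S\}$ is a finite state space, $\mathcal A$ is a finite nonempty action space, $p(j|i,a)$ is the probability of moving from state $i$ to state $j$ under action $a$, and $r(i,a)\in\mathbb R$ is the reward. $\mathcal D$ is the (finite) set of stationary deterministic policies $d:\mathcal S\to\mathcal A$. For $d\in\mathcal D$, $\bm P^d$ is the $S\times S$ transition matrix with entries $p(j|i,d(i))$. Standing assumption: for every $d\in\mathcal D$ the Markov chain with matrix $\bm P^d$ is a unichain (a single recurrent class plus possibly transient states), so it has a unique stationary distribution $\bm\pi^d=(\pi^d(i))_{i\in\mathcal S}$, with $\bm\pi^d\bm P^d=\bm\pi^d$ and $\sum_i\pi^d(i)=1$. Long-run mean: $\mu^d=\sum_{i\in\mathcal S}\pi^d(i)\,r(i,d(i))$. Long-run (steady-state) variance: $\sigma^d=\sum_{i\in\mathcal S}\pi^d(i)\,(r(i,d(i))-\mu^d)^2$ (note that $\sigma^d$ denotes the variance itself). Pseudo variance with pseudo mean $y\in\mathbb R$: $\tilde\sigma^d(y)=\sum_{i\in\mathcal S}\pi^d(i)\,(r(i,d(i))-y)^2$. *)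

theory Defs
  imports "HOL-Probability.Probability"
begin

text \<open>Note that \<open>*\<close> on \<open>real ^ 's ^ 's\<close> is the componentwise product; the row vector times
  matrix product is \<open>v*\<close>.\<close>

text \<open>\<open>first_passage P n i j\<close> is the probability that the chain with transition matrix \<open>P\<close>, started
  in \<open>i\<close> at time 0, is in \<open>j\<close> at time \<open>n + 1\<close> without having been in \<open>j\<close> at any of the times
  \<open>1, \<dots>, n\<close>.\<close>

primrec first_passage :: "real ^ 's ^ 's \<Rightarrow> nat \<Rightarrow> 's :: finite \<Rightarrow> 's \<Rightarrow> real" where
  "first_passage P 0 i j = P $ i $ j"
| "first_passage P (Suc n) i j = (\<Sum>k\<in>UNIV - {j}. P $ i $ k * first_passage P n k j)"

text \<open>The sum below is the probability of ever returning to \<open>i\<close>; states that are not recurrent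
  are transient.\<close>

definition recurrent :: "real ^ 's ^ 's \<Rightarrow> 's :: finite \<Rightarrow> bool" where
  "recurrent P i \<longleftrightarrow> (\<lambda>n. first_passage P n i i) sums 1"

definition accessible :: "real ^ 's ^ 's \<Rightarrow> ('s :: finite \<times> 's) set" where
  "accessible P = {(i, j). P $ i $ j > 0}\<^sup>*"

definition communicating_class :: "real ^ 's ^ 's \<Rightarrow> 's :: finite \<Rightarrow> 's set" where
  "communicating_class P i = {j. (i, j) \<in> accessible P \<and> (j, i) \<in> accessible P}"

definition recurrent_classes :: "real ^ 's ^ 's \<Rightarrow> 's :: finite set set" where
  "recurrent_classes P = {communicating_class P i | i. recurrent P i}"

definition unichain :: "real ^ 's ^ 's :: finite \<Rightarrow> bool" where
  "unichain P \<longleftrightarrow> (\<exists>!C. C \<in> recurrent_classes P)"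

definition is_stationary_distribution :: "real ^ 's ^ 's \<Rightarrow> real ^ 's :: finite \<Rightarrow> bool" where
  "is_stationary_distribution P q \<longleftrightarrow>
     (\<forall>i. q $ i \<ge> 0) \<and> (\<Sum>i\<in>UNIV. q $ i) = 1 \<and> q v* P = q"

text \<open>Meaningful only when there is exactly one stationary distribution, e.g. for unichains.\<close>

definition stationary_distribution :: "real ^ 's ^ 's \<Rightarrow> real ^ 's :: finite" where
  "stationary_distribution P = (THE q. is_stationary_distribution P q)"

text \<open>In the following, \<open>pmf (p i a) j\<close> is the probability of moving from \<open>i\<close> to \<open>j\<close> under action
  \<open>a\<close>, and a stationary deterministic policy is any function \<open>d :: 's \<Rightarrow> 'a\<close>.\<close>

definition policy_matrix :: "('s \<Rightarrow> 'a \<Rightarrow> 's pmf) \<Rightarrow> ('s \<Rightarrow> 'a) \<Rightarrow> real ^ 's ^ 's :: finite" where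
  "policy_matrix p d = (\<chi> i j. pmf (p i (d i)) j)"

definition policy_stationary :: "('s \<Rightarrow> 'a \<Rightarrow> 's pmf) \<Rightarrow> ('s \<Rightarrow> 'a) \<Rightarrow> real ^ 's :: finite" where
  "policy_stationary p d = stationary_distribution (policy_matrix p d)"

definition long_run_mean ::
  "('s \<Rightarrow> 'a \<Rightarrow> 's pmf) \<Rightarrow> ('s :: finite \<Rightarrow> 'a \<Rightarrow> real) \<Rightarrow> ('s \<Rightarrow> 'a) \<Rightarrow> real" where
  "long_run_mean p r d = (\<Sum>i\<in>UNIV. policy_stationary p d $ i * r i (d i))"

definition long_run_variance ::
  "('s \<Rightarrow> 'a \<Rightarrow> 's pmf) \<Rightarrow> ('s :: finite \<Rightarrow> 'a \<Rightarrow> real) \<Rightarrow> ('s \<Rightarrow> 'a) \<Rightarrow> real" where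
  "long_run_variance p r d =
     (\<Sum>i\<in>UNIV. policy_stationary p d $ i * (r i (d i) - long_run_mean p r d)\<^sup>2)"

definition pseudo_variance ::
  "('s \<Rightarrow> 'a \<Rightarrow> 's pmf) \<Rightarrow> ('s :: finite \<Rightarrow> 'a \<Rightarrow> real) \<Rightarrow> ('s \<Rightarrow> 'a) \<Rightarrow> real \<Rightarrow> real" where
  "pseudo_variance p r d y = (\<Sum>i\<in>UNIV. policy_stationary p d $ i * (r i (d i) - y)\<^sup>2)"

definition mean_variance_objective ::
  "('s \<Rightarrow> 'a \<Rightarrow> 's pmf) \<Rightarrow> ('s :: finite \<Rightarrow> 'a \<Rightarrow> real) \<Rightarrow> real \<Rightarrow> ('s \<Rightarrow> 'a) \<Rightarrow> real" where
  "mean_variance_objective p r \<beta> d = \<beta> * long_run_variance p r d - long_run_mean p r d"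

definition pseudo_objective ::
  "('s \<Rightarrow> 'a \<Rightarrow> 's pmf) \<Rightarrow> ('s :: finite \<Rightarrow> 'a \<Rightarrow> real) \<Rightarrow> real \<Rightarrow> real \<Rightarrow> ('s \<Rightarrow> 'a) \<Rightarrow> real" where
  "pseudo_objective p r \<beta> y d = \<beta> * pseudo_variance p r d y - long_run_mean p r d"

definition optimal_pseudo_objective ::
  "('s \<Rightarrow> 'a \<Rightarrow> 's pmf) \<Rightarrow> ('s :: finite \<Rightarrow> 'a :: finite \<Rightarrow> real) \<Rightarrow> real \<Rightarrow> real \<Rightarrow> real" where
  "optimal_pseudo_objective p r \<beta> y = (MIN d. pseudo_objective p r \<beta> y d)"

end

theory Submission
  imports Defs
begin

text \<open>
  Since a stationary distribution \<open>\<pi>\<close> has total mass 1, the bias-variance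
  decomposition \<open>\<Sum>i. \<pi> i * (r i - y)\<^sup>2 = \<sigma> + (y -
  \<mu>)\<^sup>2\<close> turns the pseudo objective of a policy \<open>d\<close> into its
  mean-variance objective plus \<open>\<beta> * (y - \<mu>\<^sup>d)\<^sup>2\<close> (lemma
  \<open>pseudo_objective_eq\<close>). The optimal pseudo objective is thus the lower envelope of
  finitely many parabolas which all have the leading coefficient \<open>\<beta>\<close>
  (\<open>piecewise_lower_envelope\<close>, \<open>lower_envelope_min\<close>). The difference of
  two of them is affine, so the set of those \<open>y\<close> at which a given policy attains the
  envelope is an intersection of solution sets of affine inequalities, hence a closed interval
  (possibly empty), and on it the envelope is a single convex parabola. Continuity follows by
  pasting these finitely many closed pieces. The minimum of the parabola of \<open>d\<close> is
  the mean-variance objective of \<open>d\<close>, attained at \<open>y = \<mu>\<^sup>d\<close>;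
  minimising over \<open>y\<close> and over \<open>d\<close> in either order gives the same value,
  and a policy attaining the envelope at a global minimiser has a mean-variance objective at most
  that value.

  The probabilistic input is that a unichain has exactly one stationary distribution, which makes
  the definite description in its definition meaningful. Existence
  (\<open>ex_stationary_distribution\<close>) holds for every row stochastic matrix
  \<open>P\<close>: as \<open>P - 1\<close> kills the constant column vector it also has a nonzero
  left kernel vector \<open>w\<close>, and then \<open>\<bar>w\<bar>\<close> is a left fixed
  vector as well, because \<open>\<bar>w\<bar> \<le> \<bar>w\<bar> P\<close> componentwise while
  both sides have the same total mass. Uniqueness (\<open>stationary_distribution_unique\<close>)
  needs a state that is accessible from every state. Every state reaches an essential one, that
  is, one accessible from every state it leads to; essential states are recurrent by a maximum
  principle for the probability of never returning (\<open>recurrent_if_essential\<close>), so in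
  a unichain all of them lie in the same class. The positive and the negative part of the
  difference of two stationary distributions are nonnegative left fixed vectors, and so each of
  them vanishes or is positive at the common accessible state; as they cannot both be positive
  there, the difference has a constant sign, and its total mass is zero.
\<close>

section \<open>Row stochastic matrices and their left fixed vectors\<close>

definition row_stochastic :: "real ^ 's ^ 's :: finite \<Rightarrow> bool" where
  "row_stochastic P \<longleftrightarrow> (\<forall>i j. P $ i $ j \<ge> 0) \<and> (\<forall>i. (\<Sum>j\<in>UNIV. P $ i $ j) = 1)"

lemma row_stochastic_nonneg: "row_stochastic P \<Longrightarrow> P $ i $ j \<ge> 0"
  by (simp add: row_stochastic_def)

lemma row_stochastic_sum: "row_stochastic P \<Longrightarrow> (\<Sum>j\<in>UNIV. P $ i $ j) = 1"
  by (simp add: row_stochastic_def)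

lemma row_stochastic_policy_matrix: "row_stochastic (policy_matrix p d)"
  by (simp add: row_stochastic_def policy_matrix_def sum_pmf_eq_1)

lemma sum_vector_matrix_mult:
  assumes "row_stochastic P"
  shows "(\<Sum>j\<in>UNIV. (w v* P) $ j) = (\<Sum>i\<in>UNIV. w $ i)"
proof -
  have "(\<Sum>j\<in>UNIV. (w v* P) $ j) = (\<Sum>i\<in>UNIV. w $ i * (\<Sum>j\<in>UNIV. P $ i $ j))"
    by (simp add: vector_matrix_mult_def sum_distrib_left) (rule sum.swap)
  then show ?thesis
    using assms by (simp add: row_stochastic_sum)
qed

text \<open>The triangle inequality gives \<open>\<bar>w\<bar> \<le> \<bar>w\<bar> P\<close> in every component; since \<open>P\<close> preserves the
  total mass, no component can be strict.\<close>

lemma abs_left_fixed_vector: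
  assumes P: "row_stochastic P" and w: "w v* P = w"
  shows "(\<chi> i. \<bar>w $ i\<bar>) v* P = (\<chi> i. \<bar>w $ i\<bar>)"
proof -
  define u where "u = (\<chi> i. \<bar>w $ i\<bar>)"
  have le: "u $ j \<le> (u v* P) $ j" for j
  proof -
    have "u $ j = \<bar>(w v* P) $ j\<bar>"
      by (simp add: w u_def)
    also have "\<dots> \<le> (\<Sum>i\<in>UNIV. \<bar>w $ i * P $ i $ j\<bar>)"
      by (simp add: vector_matrix_mult_def sum_abs)
    also have "\<dots> = (u v* P) $ j"
      by (simp add: vector_matrix_mult_def u_def abs_mult row_stochastic_nonneg[OF P])
    finally show ?thesis .
  qed
  have "(\<Sum>j\<in>UNIV. (u v* P) $ j - u $ j) = 0"
    by (simp add: sum_subtractf sum_vector_matrix_mult[OF P])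
  then have "\<forall>j. (u v* P) $ j - u $ j = 0"
    using le by (subst (asm) sum_nonneg_eq_0_iff) auto
  then show ?thesis
    unfolding u_def[symmetric] by (simp add: vec_eq_iff)
qed

lemma left_fixed_vector_pos_accessible:
  assumes P: "row_stochastic P" and w: "w v* P = w" and nonneg: "\<And>i. w $ i \<ge> 0"
    and acc: "(i, j) \<in> accessible P" and pos: "w $ i > 0"
  shows "w $ j > 0"
  using acc[unfolded accessible_def] pos
proof (induction rule: rtrancl_induct)
  case (step k l)
  then have "0 < w $ k * P $ k $ l"
    by simp
  also have "\<dots> \<le> (\<Sum>m\<in>UNIV. w $ m * P $ m $ l)"
    by (intro member_le_sum) (auto simp: nonneg row_stochastic_nonneg[OF P])
  also have "\<dots> = (w v* P) $ l"
    by (simp add: vector_matrix_mult_def)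
  also have "\<dots> = w $ l"
    by (simp add: w)
  finally show ?case .
qed simp

lemma ex_stationary_distribution:
  assumes P: "row_stochastic P"
  shows "\<exists>q. is_stationary_distribution P q"
proof -
  define A where "A = P - mat 1"
  have "A *v 1 = 0"
    by (simp add: A_def matrix_vector_mult_diff_rdistrib vec_eq_iff)
       (simp add: matrix_vector_mult_def row_stochastic_sum[OF P])
  moreover have "(1 :: real ^ 'a) \<noteq> 0"
    by (simp add: vec_eq_iff)
  ultimately have "\<nexists>B. B ** A = mat 1"
    by (auto simp: matrix_left_invertible_ker)
  then have "\<nexists>B. B ** transpose A = mat 1"
    by (simp only: left_invertible_transpose matrix_left_right_inverse[of A] simp_thms)
  then obtain w where "w \<noteq> 0" and "w v* A = 0"
    by (auto simp: matrix_left_invertible_ker)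
  then have w: "w v* P = w"
    by (simp add: A_def vector_matrix_mult_diff_rdistrib)
  define u where "u = (\<chi> i. \<bar>w $ i\<bar>)"
  have u: "u v* P = u"
    unfolding u_def by (rule abs_left_fixed_vector[OF P w])
  have nonneg: "u $ i \<ge> 0" for i
    by (simp add: u_def)
  define s where "s = (\<Sum>i\<in>UNIV. u $ i)"
  obtain k where "w $ k \<noteq> 0"
    using \<open>w \<noteq> 0\<close> by (auto simp: vec_eq_iff)
  then have "s > 0"
    unfolding s_def by (intro sum_pos2[of _ k]) (auto simp: u_def)
  then have "is_stationary_distribution P ((1 / s) *\<^sub>R u)"
    by (auto simp: is_stationary_distribution_def scaleR_vector_matrix_assoc u nonneg
        simp flip: sum_divide_distrib s_def)
  then show ?thesis ..
qed

text \<open>The state \<open>c\<close> prevents a left fixed vector from having both positive and negative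
  entries: each sign would be transported to \<open>c\<close>.\<close>

lemma stationary_distribution_unique:
  assumes P: "row_stochastic P" and c: "\<And>i. (i, c) \<in> accessible P"
    and q: "is_stationary_distribution P q" and q': "is_stationary_distribution P q'"
  shows "q = q'"
proof -
  define w where "w = q - q'"
  define u where "u = (\<chi> i. \<bar>w $ i\<bar>)"
  have w: "w v* P = w"
    using q q' by (simp add: w_def vector_matrix_mult_diff_distrib is_stationary_distribution_def)
  have u: "u v* P = u"
    unfolding u_def by (rule abs_left_fixed_vector[OF P w])
  have u_nth: "u $ i = \<bar>w $ i\<bar>" for i
    by (simp add: u_def)
  have sum0: "(\<Sum>i\<in>UNIV. w $ i) = 0"
    using q q' by (simp add: w_def sum_subtractf is_stationary_distribution_def)
  \<comment> \<open>\<open>u + w\<close> and \<open>u - w\<close> are twice the positive and the negative part of \<open>w\<close>.\<close>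
  have pos: "w $ c > 0" if "w $ i > 0" for i
  proof -
    have "(u + w) $ c > 0"
      by (rule left_fixed_vector_pos_accessible[OF P _ _ c[of i]])
         (use that in \<open>auto simp: vector_matrix_left_distrib u w u_nth\<close>)
    then show ?thesis
      by (auto simp: u_nth abs_if split: if_splits)
  qed
  have neg: "w $ c < 0" if "w $ i < 0" for i
  proof -
    have "(u - w) $ c > 0"
      by (rule left_fixed_vector_pos_accessible[OF P _ _ c[of i]])
         (use that in \<open>auto simp: vector_matrix_mult_diff_distrib u w u_nth\<close>)
    then show ?thesis
      by (auto simp: u_nth abs_if split: if_splits)
  qed
  consider "\<forall>i. w $ i \<ge> 0" | "\<forall>i. - w $ i \<ge> 0"
  proof (cases "w $ c < 0")
    case True
    then have "- w $ i \<ge> 0" for i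
      using pos[of i] by linarith
    then show ?thesis
      using that(2) by blast
  next
    case False
    then have "w $ i \<ge> 0" for i
      using neg[of i] by linarith
    then show ?thesis
      using that(1) by blast
  qed
  then have "\<forall>i. w $ i = 0"
  proof cases
    case 1
    then show ?thesis
      using sum0 by (simp add: sum_nonneg_eq_0_iff)
  next
    case 2
    have "(\<Sum>i\<in>UNIV. - w $ i) = 0"
      using sum0 by (simp add: sum_negf)
    then show ?thesis
      using 2 by (subst (asm) sum_nonneg_eq_0_iff) auto
  qed
  then show ?thesis
    by (simp add: w_def vec_eq_iff)
qed

section \<open>Recurrence of essential states\<close>

lemma first_passage_nonneg: "row_stochastic P \<Longrightarrow> first_passage P n i j \<ge> 0"
  by (induction n arbitrary: i) (auto intro!: sum_nonneg simp: row_stochastic_nonneg)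

text \<open>The probability that the chain started in \<open>k\<close> avoids \<open>i\<close> at the times \<open>1, \<dots>, n\<close>.\<close>

definition avoid_prob :: "real ^ 's ^ 's \<Rightarrow> 's :: finite \<Rightarrow> nat \<Rightarrow> 's \<Rightarrow> real" where
  "avoid_prob P i n k = 1 - (\<Sum>m<n. first_passage P m k i)"

lemma avoid_prob_Suc:
  assumes P: "row_stochastic P"
  shows "avoid_prob P i (Suc n) k = (\<Sum>j\<in>UNIV - {i}. P $ k $ j * avoid_prob P i n j)"
proof -
  have "(\<Sum>m<Suc n. first_passage P m k i) =
      P $ k $ i + (\<Sum>j\<in>UNIV - {i}. P $ k $ j * (\<Sum>m<n. first_passage P m j i))"
    by (simp add: sum.lessThan_Suc_shift sum_distrib_left del: sum.lessThan_Suc) (rule sum.swap)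
  moreover have "(\<Sum>j\<in>UNIV - {i}. P $ k $ j) = 1 - P $ k $ i"
    using row_stochastic_sum[OF P, of k] by (simp add: sum_diff1)
  ultimately show ?thesis
    by (simp add: avoid_prob_def right_diff_distrib sum_subtractf)
qed

lemma avoid_prob_nonneg: "row_stochastic P \<Longrightarrow> avoid_prob P i n k \<ge> 0"
proof (induction n arbitrary: k)
  case 0
  then show ?case
    by (simp add: avoid_prob_def)
next
  case (Suc n)
  then show ?case
    unfolding avoid_prob_Suc[OF Suc.prems]
    by (intro sum_nonneg mult_nonneg_nonneg row_stochastic_nonneg) auto
qed

text \<open>The probability \<open>h k\<close> of never hitting \<open>i\<close> from \<open>k\<close> is an average of the values of \<open>h\<close> at the
  successors of \<open>k\<close> in which \<open>i\<close> counts as 0. Hence, where \<open>h\<close> attains a positive maximum \<open>M\<close> over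
  the states accessible from \<open>i\<close>, no transition leads to \<open>i\<close> and all successors attain \<open>M\<close> too.
  This set of maximisers is therefore closed under transitions and cannot reach \<open>i\<close>.\<close>

lemma recurrent_if_essential:
  assumes P: "row_stochastic P"
    and ess: "\<And>j. (i, j) \<in> accessible P \<Longrightarrow> (j, i) \<in> accessible P"
  shows "recurrent P i"
proof -
  have mono: "monoseq (\<lambda>n. avoid_prob P i n k)" for k
    unfolding monoseq_Suc by (auto simp: avoid_prob_def first_passage_nonneg[OF P])
  have bdd: "Bseq (\<lambda>n. avoid_prob P i n k)" for k
  proof (rule BseqI'[where K = 1])
    show "norm (avoid_prob P i n k) \<le> 1" for n
      using avoid_prob_nonneg[OF P, of i n k]
        sum_nonneg[of "{..<n}" "\<lambda>m. first_passage P m k i"] first_passage_nonneg[OF P]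
      by (auto simp: avoid_prob_def)
  qed
  define h where "h k = lim (\<lambda>n. avoid_prob P i n k)" for k
  have lim_h: "(\<lambda>n. avoid_prob P i n k) \<longlonglongrightarrow> h k" for k
    unfolding h_def using Bseq_monoseq_convergent[OF bdd mono] by (simp add: convergent_LIMSEQ_iff)
  have h_nonneg: "h k \<ge> 0" for k
    by (rule LIMSEQ_le_const[OF lim_h]) (auto simp: avoid_prob_nonneg[OF P])
  have h_rec: "h k = (\<Sum>j\<in>UNIV - {i}. P $ k $ j * h j)" for k
  proof (rule LIMSEQ_unique)
    show "(\<lambda>n. avoid_prob P i (Suc n) k) \<longlonglongrightarrow> h k"
      using lim_h by (rule LIMSEQ_Suc)
    show "(\<lambda>n. avoid_prob P i (Suc n) k) \<longlonglongrightarrow> (\<Sum>j\<in>UNIV - {i}. P $ k $ j * h j)"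
      unfolding avoid_prob_Suc[OF P] by (intro tendsto_intros lim_h)
  qed
  define R where "R = {j. (i, j) \<in> accessible P}"
  have R_step: "j \<in> R" if "k \<in> R" "P $ k $ j > 0" for k j
    using that unfolding R_def accessible_def by (auto intro: rtrancl_into_rtrancl)
  have i_R: "i \<in> R"
    by (simp add: R_def accessible_def)
  define M where "M = Max (h ` R)"
  have h_le: "h j \<le> M" if "j \<in> R" for j
    unfolding M_def using that by simp
  have "M = 0"
  proof (rule ccontr)
    assume "M \<noteq> 0"
    then have M: "M > 0"
      using h_le[OF i_R] h_nonneg[of i] by linarith
    have max_step: "j \<noteq> i \<and> h j = M" if k: "k \<in> R" "h k = M" "P $ k $ j > 0" for k j
    proof -
      \<comment> \<open>\<open>g\<close> is \<open>h\<close> stopped at \<open>i\<close>; the nonnegative gaps \<open>M - g\<close> have mean zero under row \<open>k\<close>.\<close>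
      define g where "g l = (if l = i then 0 else h l)" for l
      have "(\<Sum>l\<in>UNIV. P $ k $ l * g l) = h k"
        unfolding h_rec[of k] g_def by (rule sum.mono_neutral_cong_right) auto
      then have "(\<Sum>l\<in>UNIV. P $ k $ l * (M - g l)) = 0"
        using row_stochastic_sum[OF P, of k] k
        by (simp add: right_diff_distrib sum_subtractf flip: sum_distrib_right)
      moreover have "P $ k $ l * (M - g l) \<ge> 0" for l
      proof (cases "P $ k $ l > 0")
        case True
        then have "h l \<le> M"
          using R_step h_le k by blast
        then show ?thesis
          using True M by (simp add: g_def)
      next
        case False
        then show ?thesis
          using row_stochastic_nonneg[OF P, of k l] by simp
      qed
      ultimately have "P $ k $ j * (M - g j) = 0"
        by (subst (asm) sum_nonneg_eq_0_iff) auto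
      then show ?thesis
        using k M by (auto simp: g_def split: if_splits)
    qed
    have "finite (h ` R)" "h ` R \<noteq> {}"
      using i_R by auto
    then obtain k where k: "k \<in> R" "h k = M"
      using Max_in unfolding M_def by (metis imageE)
    have closed: "j \<in> R \<and> h j = M" if "(k', j) \<in> accessible P" "k' \<in> R" "h k' = M" for k' j
      using that(1)[unfolded accessible_def]
      by (induction rule: rtrancl_induct) (use that max_step R_step in auto)
    \<comment> \<open>The maximisers contain \<open>i\<close> itself, so a path of positive length back to \<open>i\<close> is needed: it
      starts with an arbitrary transition out of \<open>i\<close>.\<close>
    have "h i = M"
      using closed k ess unfolding R_def by blast
    obtain j where j: "P $ i $ j > 0"
      using row_stochastic_sum[OF P, of i] row_stochastic_nonneg[OF P, of i]
      by (metis not_less order_antisym sum.neutral zero_neq_one)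
    then have "j \<noteq> i" "h j = M" "j \<in> R"
      using max_step i_R \<open>h i = M\<close> R_step by blast+
    then have "(j, i) \<in> {(i, j). P $ i $ j > 0}\<^sup>*"
      using ess by (simp add: R_def accessible_def)
    then obtain l where "(j, l) \<in> accessible P" "P $ l $ i > 0"
      using \<open>j \<noteq> i\<close> unfolding accessible_def by (auto elim: rtranclE)
    then show False
      using closed[of j l] max_step[of l i] \<open>h j = M\<close> \<open>j \<in> R\<close> by blast
  qed
  then have "h i = 0"
    using h_le[OF i_R] h_nonneg[of i] by simp
  then have "(\<lambda>n. 1 - avoid_prob P i n i) \<longlonglongrightarrow> 1"
    using tendsto_diff[OF tendsto_const[of 1] lim_h[of i]] by simp
  then show ?thesis
    by (simp add: recurrent_def sums_def avoid_prob_def)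
qed

text \<open>Among the states accessible from \<open>k\<close>, one that reaches as few states as possible is
  essential: whatever it leads to reaches a subset of these states, hence all of them.\<close>

lemma ex_essential_accessible:
  fixes P :: "real ^ 's ^ 's :: finite"
  shows "\<exists>i. (k, i) \<in> accessible P \<and> (\<forall>j. (i, j) \<in> accessible P \<longrightarrow> (j, i) \<in> accessible P)"
proof -
  define R where "R i = {j. (i, j) \<in> accessible P}" for i
  have refl: "i \<in> R i" for i
    by (simp add: R_def accessible_def)
  have trans: "R j \<subseteq> R i" if "j \<in> R i" for i j
    using that by (auto simp: R_def accessible_def)
  obtain i where i: "i \<in> R k" and min: "\<And>j. j \<in> R k \<Longrightarrow> card (R i) \<le> card (R j)"
    using ex_has_least_nat[of "\<lambda>i. i \<in> R k" k "\<lambda>i. card (R i)"] refl by auto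
  have "i \<in> R j" if j: "j \<in> R i" for j
  proof -
    have "R j = R i"
      using trans[OF j] min[of j] trans[OF i] j by (intro card_seteq) auto
    then show ?thesis
      using refl by simp
  qed
  then show ?thesis
    using i by (auto simp: R_def)
qed

section \<open>The stationary distribution of a unichain\<close>

lemma unichain_ex_accessible_from_all:
  assumes P: "row_stochastic P" and "unichain P"
  shows "\<exists>c. \<forall>i. (i, c) \<in> accessible P"
proof -
  define ess where "ess i \<longleftrightarrow> (\<forall>j. (i, j) \<in> accessible P \<longrightarrow> (j, i) \<in> accessible P)" for i
  have class_eq: "communicating_class P i = communicating_class P j" if "ess i" "ess j" for i j
  proof -
    have "communicating_class P l \<in> recurrent_classes P" if "ess l" for l
      using recurrent_if_essential[OF P, of l] that by (auto simp: recurrent_classes_def ess_def)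
    then show ?thesis
      using \<open>unichain P\<close> that by (auto simp: unichain_def)
  qed
  obtain c where c: "ess c"
    using ex_essential_accessible[where P = P] by (auto simp: ess_def)
  have "(k, c) \<in> accessible P" for k
  proof -
    obtain i where i: "(k, i) \<in> accessible P" "ess i"
      using ex_essential_accessible[where P = P] by (auto simp: ess_def)
    have "c \<in> communicating_class P c"
      by (simp add: communicating_class_def accessible_def)
    then have "(i, c) \<in> accessible P"
      using class_eq[OF i(2) c] by (auto simp: communicating_class_def)
    then show ?thesis
      using i(1) unfolding accessible_def by (rule rtrancl_trans[rotated])
  qed
  then show ?thesis
    by blast
qed

lemma is_stationary_distribution_unichain:
  assumes P: "row_stochastic P" and "unichain P"
  shows "is_stationary_distribution P (stationary_distribution P)"
proof -
  obtain c where "\<And>i. (i, c) \<in> accessible P"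
    using unichain_ex_accessible_from_all[OF assms] by blast
  then have "\<exists>!q. is_stationary_distribution P q"
    using ex_stationary_distribution[OF P] stationary_distribution_unique[OF P] by blast
  then show ?thesis
    unfolding stationary_distribution_def by (rule theI')
qed

lemma sum_policy_stationary:
  assumes "unichain (policy_matrix p d)"
  shows "(\<Sum>i\<in>UNIV. policy_stationary p d $ i) = 1"
  using is_stationary_distribution_unichain[OF row_stochastic_policy_matrix assms]
  by (simp add: policy_stationary_def is_stationary_distribution_def)

section \<open>The pseudo objective as a parabola\<close>

lemma pseudo_variance_eq:
  assumes "unichain (policy_matrix p d)"
  shows "pseudo_variance p r d y = long_run_variance p r d + (y - long_run_mean p r d)\<^sup>2"
proof -
  define q where "q i = policy_stationary p d $ i" for i
  define m where "m = long_run_mean p r d"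
  have q: "(\<Sum>i\<in>UNIV. q i) = 1"
    using sum_policy_stationary[OF assms] by (simp add: q_def)
  have m: "(\<Sum>i\<in>UNIV. q i * r i (d i)) = m"
    by (simp add: m_def q_def long_run_mean_def)
  have "(\<Sum>i\<in>UNIV. q i * (r i (d i) - y)\<^sup>2) =
      (\<Sum>i\<in>UNIV. q i * (r i (d i) - m)\<^sup>2 + 2 * (m - y) * (q i * r i (d i)) + (y\<^sup>2 - m\<^sup>2) * q i)"
    by (intro sum.cong) (auto simp: power2_eq_square algebra_simps)
  also have "\<dots> = (\<Sum>i\<in>UNIV. q i * (r i (d i) - m)\<^sup>2) + 2 * (m - y) * m + (y\<^sup>2 - m\<^sup>2)"
    by (simp add: sum.distrib q m flip: sum_distrib_left)
  also have "\<dots> = (\<Sum>i\<in>UNIV. q i * (r i (d i) - m)\<^sup>2) + (y - m)\<^sup>2"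
    by (simp add: power2_eq_square algebra_simps)
  finally show ?thesis
    by (simp add: pseudo_variance_def long_run_variance_def q_def m_def)
qed

lemma pseudo_objective_eq:
  assumes "unichain (policy_matrix p d)"
  shows "pseudo_objective p r \<beta> y d =
    mean_variance_objective p r \<beta> d + \<beta> * (y - long_run_mean p r d)\<^sup>2"
  by (simp add: pseudo_objective_def mean_variance_objective_def pseudo_variance_eq[OF assms]
      algebra_simps)

section \<open>Lower envelopes of parabolas with a common leading coefficient\<close>

lemma MIN_eqI:
  fixes f :: "'d :: finite \<Rightarrow> real"
  assumes "\<And>e. f d \<le> f e"
  shows "(MIN e. f e) = f d"
  using assms by (intro Min_eqI) auto

lemma MIN_le:
  fixes f :: "'d :: finite \<Rightarrow> real"
  shows "(MIN e. f e) \<le> f d"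
  by (intro Min_le) auto

lemma ex_MIN_attained:
  fixes f :: "'d :: finite \<Rightarrow> real"
  shows "\<exists>d. (MIN e. f e) = f d"
proof -
  have "(MIN e. f e) \<in> range f"
    by (intro Min_in) auto
  then show ?thesis
    by blast
qed

lemma piecewise_lower_envelope:
  fixes g m :: "'d :: finite \<Rightarrow> real" and \<beta> :: real
  defines "E \<equiv> \<lambda>y. MIN d. g d + \<beta> * (y - m d)\<^sup>2"
  assumes "\<beta> \<ge> 0"
  shows "\<exists>\<I> :: real set set. finite \<I> \<and> \<Union>\<I> = UNIV \<and>
    (\<forall>I\<in>\<I>. I \<noteq> {} \<and> is_interval I \<and> closed I \<and>
      (\<exists>a b c. a \<ge> 0 \<and> (\<forall>y\<in>I. E y = a * y\<^sup>2 + b * y + c)))"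
proof -
  define F where "F d y = g d + \<beta> * (y - m d)\<^sup>2" for d y
  define I where "I d = {y. \<forall>e. F d y \<le> F e y}" for d
  have E: "E y = (MIN d. F d y)" for y
    by (simp add: E_def F_def)
  have quad: "F d y = \<beta> * y\<^sup>2 + (- 2 * \<beta> * m d) * y + (g d + \<beta> * (m d)\<^sup>2)" for d y
    by (simp add: F_def power2_eq_square algebra_simps)
  \<comment> \<open>The quadratic terms cancel in each comparison; what is left is affine in \<open>y\<close>.\<close>
  have I_eq: "I d = (\<Inter>e. {y. inner (2 * \<beta> * (m e - m d)) y \<le>
      g e + \<beta> * (m e)\<^sup>2 - (g d + \<beta> * (m d)\<^sup>2)})" for d
    unfolding I_def quad by (auto simp: algebra_simps)
  have closed: "closed (I d)" for d
    unfolding I_eq by (intro closed_INT ballI closed_halfspace_le)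
  have interval: "is_interval (I d)" for d
    unfolding I_eq is_interval_convex_1 by (intro convex_INT convex_halfspace_le)
  have cover: "\<exists>d. y \<in> I d" for y
  proof -
    obtain d where "(MIN e. F e y) = F d y"
      using ex_MIN_attained by blast
    then have "y \<in> I d"
      using MIN_le[of "\<lambda>e. F e y"] by (simp add: I_def)
    then show ?thesis ..
  qed
  have piece: "E y = \<beta> * y\<^sup>2 + (- 2 * \<beta> * m d) * y + (g d + \<beta> * (m d)\<^sup>2)" if "y \<in> I d" for d y
    using that unfolding E quad[symmetric] I_def by (intro MIN_eqI) auto
  show ?thesis
  proof (intro exI[of _ "range I - {{}}"] conjI ballI)
    show "finite (range I - {{}})"
      by simp
    show "\<Union>(range I - {{}}) = UNIV"
      using cover by fast
  next
    fix J
    assume "J \<in> range I - {{}}"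
    then obtain d where J: "J = I d" "J \<noteq> {}"
      by auto
    then show "J \<noteq> {}" "is_interval J" "closed J"
      using closed interval by auto
    show "\<exists>a b c. a \<ge> 0 \<and> (\<forall>y\<in>J. E y = a * y\<^sup>2 + b * y + c)"
      using \<open>\<beta> \<ge> 0\<close> piece unfolding J(1) by blast
  qed
qed

lemma continuous_on_piecewise_quadratic:
  fixes f :: "real \<Rightarrow> real"
  assumes "finite \<I>" and "\<Union>\<I> = UNIV"
    and "\<And>I. I \<in> \<I> \<Longrightarrow> closed I \<and> (\<exists>a b c. \<forall>y\<in>I. f y = a * y\<^sup>2 + b * y + c)"
  shows "continuous_on UNIV f"
proof -
  have "continuous_on I f" if I: "I \<in> \<I>" for I
  proof -
    obtain a b c where "\<forall>y\<in>I. f y = a * y\<^sup>2 + b * y + c"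
      using assms(3)[OF I] by blast
    then have "continuous_on I f \<longleftrightarrow> continuous_on I (\<lambda>y. a * y\<^sup>2 + b * y + c)"
      by (intro continuous_on_cong) auto
    moreover have "continuous_on I (\<lambda>y. a * y\<^sup>2 + b * y + c)"
      by (intro continuous_intros)
    ultimately show ?thesis
      by simp
  qed
  then have "continuous_on (\<Union>I\<in>\<I>. I) f"
    using assms by (intro continuous_on_closed_Union) auto
  then show ?thesis
    using assms(2) by simp
qed

text \<open>Exchanging the two minimisations: for fixed \<open>d\<close> the inner minimum over \<open>y\<close> is \<open>g d\<close>.\<close>

lemma lower_envelope_min:
  fixes g m :: "'d :: finite \<Rightarrow> real" and \<beta> :: real
  defines "E \<equiv> \<lambda>y. MIN d. g d + \<beta> * (y - m d)\<^sup>2"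
  assumes "\<beta> \<ge> 0"
  shows "(MIN d. g d) \<le> E y" and "\<exists>y. E y = (MIN d. g d)"
proof -
  have le: "(MIN d. g d) \<le> g e + \<beta> * (y - m e)\<^sup>2" for e y
    using MIN_le[of g e] \<open>\<beta> \<ge> 0\<close> by (simp add: add_increasing2)
  then show lower: "(MIN d. g d) \<le> E y" for y
    using ex_MIN_attained[of "\<lambda>d. g d + \<beta> * (y - m d)\<^sup>2"] by (auto simp: E_def)
  obtain d where d: "(MIN d. g d) = g d"
    using ex_MIN_attained by blast
  have "E (m d) \<le> g d"
    using MIN_le[of "\<lambda>e. g e + \<beta> * (m d - m e)\<^sup>2" d] by (simp add: E_def)
  then show "\<exists>y. E y = (MIN d. g d)"
    using lower[of "m d"] d by (intro exI[of _ "m d"]) simp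
qed

section \<open>The mean-variance problem\<close>


theorem lemma3:
  fixes p :: "'s :: finite \<Rightarrow> 'a :: finite \<Rightarrow> 's pmf"
    and r :: "'s \<Rightarrow> 'a \<Rightarrow> real"
    and \<beta> :: real
  assumes "\<And>d. unichain (policy_matrix p d)"
    and "\<beta> \<ge> 0"
  shows "continuous_on UNIV (optimal_pseudo_objective p r \<beta>) \<and>
    (\<exists>\<I> :: real set set. finite \<I> \<and> \<Union>\<I> = UNIV \<and>
      (\<forall>I\<in>\<I>. I \<noteq> {} \<and> is_interval I \<and> closed I \<and>
        (\<exists>a b c. a \<ge> 0 \<and> (\<forall>y\<in>I. optimal_pseudo_objective p r \<beta> y = a * y\<^sup>2 + b * y + c)))) \<and>
    (\<exists>y. is_arg_min (optimal_pseudo_objective p r \<beta>) (\<lambda>_. True) y \<and>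
      optimal_pseudo_objective p r \<beta> y = (MIN d. mean_variance_objective p r \<beta> d)) \<and>
    (\<forall>y d. is_arg_min (optimal_pseudo_objective p r \<beta>) (\<lambda>_. True) y \<longrightarrow>
      is_arg_min (pseudo_objective p r \<beta> y) (\<lambda>_. True) d \<longrightarrow>
      is_arg_min (mean_variance_objective p r \<beta>) (\<lambda>_. True) d)"
proof -
  let ?E = "optimal_pseudo_objective p r \<beta>"
  let ?g = "mean_variance_objective p r \<beta>"
  have E: "?E = (\<lambda>y. MIN d. ?g d + \<beta> * (y - long_run_mean p r d)\<^sup>2)"
    by (simp add: fun_eq_iff optimal_pseudo_objective_def pseudo_objective_eq[OF assms(1)])
  have pieces: "\<exists>\<I> :: real set set. finite \<I> \<and> \<Union>\<I> = UNIV \<and>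
      (\<forall>I\<in>\<I>. I \<noteq> {} \<and> is_interval I \<and> closed I \<and>
        (\<exists>a b c. a \<ge> 0 \<and> (\<forall>y\<in>I. ?E y = a * y\<^sup>2 + b * y + c)))"
    unfolding E by (rule piecewise_lower_envelope[OF assms(2)])
  have cont: "continuous_on UNIV ?E"
  proof -
    obtain \<I> where \<I>: "finite \<I>" "\<Union>\<I> = UNIV"
      "\<forall>I\<in>\<I>. I \<noteq> {} \<and> is_interval I \<and> closed I \<and>
        (\<exists>a b c. a \<ge> 0 \<and> (\<forall>y\<in>I. ?E y = a * y\<^sup>2 + b * y + c))"
      using pieces by blast
    show ?thesis
    proof (rule continuous_on_piecewise_quadratic[OF \<I>(1,2)])
      fix I
      assume "I \<in> \<I>"
      then show "closed I \<and> (\<exists>a b c. \<forall>y\<in>I. ?E y = a * y\<^sup>2 + b * y + c)"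
        using \<I>(3) by metis
    qed
  qed
  have lower: "(MIN d. ?g d) \<le> ?E y" for y
    unfolding E by (rule lower_envelope_min(1)[OF assms(2)])
  have attained: "\<exists>y. ?E y = (MIN d. ?g d)"
    unfolding E by (rule lower_envelope_min(2)[OF assms(2)])
  have minimiser: "is_arg_min ?E (\<lambda>_. True) y \<longleftrightarrow> ?E y = (MIN d. ?g d)" for y
    using lower attained by (metis is_arg_min_linorder order_antisym)
  have optimal: "is_arg_min ?g (\<lambda>_. True) d"
    if y: "is_arg_min ?E (\<lambda>_. True) y" and d: "is_arg_min (pseudo_objective p r \<beta> y) (\<lambda>_. True) d"
    for y d
  proof -
    have "?g d \<le> pseudo_objective p r \<beta> y d"
      using assms(2) by (simp add: pseudo_objective_eq[OF assms(1)])
    also have "\<dots> = ?E y"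
      using d unfolding optimal_pseudo_objective_def is_arg_min_linorder
      by (intro MIN_eqI[symmetric]) auto
    also have "\<dots> = (MIN d. ?g d)"
      using y minimiser by simp
    finally show ?thesis
      using MIN_le[of ?g] order_trans unfolding is_arg_min_linorder by blast
  qed
  show ?thesis
    using cont pieces attained minimiser optimal by blast
qed

end
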